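(* Let $F^1,F^2$ be regular drivers, let $Q^1,Q^2\in L^\infty(\mathcal{F}_T;\mathbb{R}^K)$, and for $k=1,2$ let $(Y^k,Z^k)$ be the solution of the BSDE with driver $F^k$ and terminal value $Q^k$. Suppose: (i) $Q^1\ge Q^2$ $\mathbb{P}$-a.s.; (ii) $\mathbb{P}$-a.s., for all $t\in\{0,\dots,T-1\}$, $F^1(\omega,t,Y^2_t,Z^2_t)\ge F^2(\omega,t,Y^2_t,Z^2_t)$; (iii) $\mathbb{P}$-a.s., for all $t\in\{0,\dots,T-1\}$ and all $i\in\{1,\dots,K\}$, $$e_i^*F^1(\omega,t,Y^2_t,Z^1_t)-e_i^*F^1(\omega,t,Y^2_t,Z^2_t)\ge\min_{j\in\mathbb{J}_t}\{e_i^*(Z^1_t-Z^2_t)(e_j-E[X_{t+1}\mid\mathcal{F}_t])\};$$ (iv) $\mathbb{P}$-a.s., for all $t\in\{0,\dots,T-1\}$, if $Y^1_t-F^1(\omega,t,Y^1_t,Z^1_t)\ge Y^2_t-F^1(\omega,t,Y^2_t,Z^1_t)$ then $Y^1_t\ge Y^2_t$. Then $Y^1\ge Y^2$ $\mathbb{P}$-a.s. (i.e. $Y^1_t\geq Y^2_t$ for all $t\in\{0,\dots,T\}$, $\mathbb{P}$-a.s.).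
   Context: Setting. $N,K\ge 1$ are integers and $T\geq 1$ is a deterministic integer. $X=(X_t)_{0\le t\le T}$ is a process on a probability space $(\Omega,\mathcal{F},\mathbb{P})$ with values in the standard basis (column) vectors $\{e_1,\dots,e_N\}$ of $\mathbb{R}^N$, and $\mathcal{F}_t$ is the completion of the $\sigma$-algebra generated by $X_0,\dots,X_t$. Put $M_t:=X_t-E[X_t\mid\mathcal{F}_{t-1}]$ for $1\le t\le T$. The superscript $*$ denotes transposition; $e_i^*v$ is the $i$th component (row) of a vector (matrix) $v$, with $e_i$ the basis vector of the appropriate dimension. Inequalities between vectors are componentwise. All adapted processes $Y$ ($\mathbb{R}^K$-valued) and $Z$ ($\mathbb{R}^{K\times N}$-valued) have $Y_t,Z_t\in L^\infty(\mathcal{F}_t)$. $\mathbb{J}_t:=\{j:\mathbb{P}(X_{t+1}=e_j\mid\mathcal{F}_t)>0\}$ (an $\mathcal{F}_t$-measurable random set of indices). Driver. A driver is an adapted map $F:\Omega\times\{0,\dots,T\}\times\mathbb{R}^K\times\mathbb{R}^{K\times N}\to\mathbb{R}^K$ with $F(\omega,t,Y_t,Z_t)\in L^\infty(\mathcal{F}_t)$ for all $t$ and all $Y_t,Z_t\in L^\infty(\mathcal{F}_t)$. Equivalence. $Z^1\sim_M Z^2$ means $Z^1_uM_{u+1}=Z^2_uM_{u+1}$ $\mathbb{P}$-a.s. for all $u\in\{0,\dots,T-1\}$. A driver $F$ is called regular here if (a) for any adapted $Y$, $Z^1\sim_MZ^2$ implies $F(\omega,t,Y_t,Z^1_t)=F(\omega,t,Y_t,Z^2_t)$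 $\mathbb{P}$-a.s. for all $t\in\{0,\dots,T-1\}$; and (b) for any adapted $Z$ and all $t\in\{0,\dots,T-1\}$, the map $Y_t\mapsto Y_t-F(\omega,t,Y_t,Z_t)$ is $\mathbb{P}$-a.s. a bijection of $\mathbb{R}^K$, up to equality $\mathbb{P}$-a.s. (i.e. it is a bijection of the set of $\mathbb{R}^K$-valued $\mathcal{F}_t$-measurable random variables, identified when a.s. equal, onto itself). BSDE. For a driver $F$ and $Q\in L^\infty(\mathcal{F}_T;\mathbb{R}^K)$, a solution of the BSDE is a pair of adapted processes $(Y,Z)$ with $Y_t-\sum_{t\le u<T}F(\omega,u,Y_u,Z_u)+\sum_{t\le u<T}Z_uM_{u+1}=Q$ $\mathbb{P}$-a.s. for all $t\in\{0,\dots,T\}$. For regular $F$ a solution exists and is unique up to indistinguishability of $Y$ and $\sim_M$ for $Z$. *)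

theory Defs
  imports "HOL-Probability.Probability"
begin

definition basis_process :: "'w measure \<Rightarrow> nat \<Rightarrow> (nat \<Rightarrow> 'w \<Rightarrow> real ^ 'n) \<Rightarrow> bool" where
  "basis_process P T X \<longleftrightarrow>
     (\<forall>t\<le>T. X t \<in> borel_measurable P \<and> (\<forall>\<omega>\<in>space P. \<exists>i. X t \<omega> = axis i 1))"

definition gen_sigma :: "'w measure \<Rightarrow> (nat \<Rightarrow> 'w \<Rightarrow> real ^ 'n) \<Rightarrow> nat \<Rightarrow> 'w measure" where
  "gen_sigma P X t = sigma (space P) {X s -` A \<inter> space P | s A. s \<le> t \<and> A \<in> sets borel}"

definition filt :: "'w measure \<Rightarrow> (nat \<Rightarrow> 'w \<Rightarrow> real ^ 'n) \<Rightarrow> nat \<Rightarrow> 'w measure" where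
  "filt P X t = completion (restr_to_subalg P (gen_sigma P X t))"

text \<open>\<open>P\<close> itself need not be complete, so \<open>filt P X t\<close> is in general only a sub-\<open>\<sigma>\<close>-algebra of
  \<^term>\<open>completion P\<close>. Since \<^const>\<open>real_cond_exp\<close> is a junk value unless its second argument
  is a subalgebra of its first, conditional expectations below are taken on \<^term>\<open>completion P\<close>,
  which has the same almost sure statements as \<open>P\<close>.\<close>

lemma subalgebra_filt:
  assumes "basis_process P T X" and "t \<le> T"
  shows "subalgebra (completion P) (filt P X t)"
proof -
  have "{X s -` A \<inter> space P | s A. s \<le> t \<and> A \<in> sets borel} \<subseteq> sets P"
    using assms by (auto simp: basis_process_def intro!: measurable_sets[where A = borel])
  then have sub: "subalgebra P (gen_sigma P X t)"
    unfolding subalgebra_def gen_sigma_def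
    by (metis (no_types, lifting) sets.sigma_sets_subset sets.space_closed sets_measure_of
        space_measure_of subset_trans)
  have "A \<in> sets (completion P)" if "A \<in> sets (filt P X t)" for A
  proof -
    obtain S N N' where A: "A = S \<union> N" "S \<in> sets (restr_to_subalg P (gen_sigma P X t))"
      "N' \<in> null_sets (restr_to_subalg P (gen_sigma P X t))" "N \<subseteq> N'"
      using \<open>A \<in> sets (filt P X t)\<close> unfolding filt_def by (auto elim: sets_completionE)
    have "S \<in> sets P"
      using A(2) sub by (auto simp: sets_restr_to_subalg[OF sub] subalgebra_def)
    moreover have "N' \<in> null_sets P"
      using null_sets_restr_to_subalg[OF sub] A(3) by auto
    ultimately show ?thesis
      using A by (auto intro: sets_completionI)
  qed
  then show ?thesis
    by (auto simp: subalgebra_def filt_def space_restr_to_subalg)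
qed

definition cond_expX ::
    "'w measure \<Rightarrow> (nat \<Rightarrow> 'w \<Rightarrow> real ^ 'n) \<Rightarrow> nat \<Rightarrow> nat \<Rightarrow> 'w \<Rightarrow> real ^ 'n" where
  "cond_expX P X t s \<omega> = (\<chi> i. real_cond_exp (completion P) (filt P X s) (\<lambda>\<omega>'. X t \<omega>' $ i) \<omega>)"

text \<open>Only used for \<open>1 \<le> t\<close>.\<close>

definition mart_diff :: "'w measure \<Rightarrow> (nat \<Rightarrow> 'w \<Rightarrow> real ^ 'n) \<Rightarrow> nat \<Rightarrow> 'w \<Rightarrow> real ^ 'n" where
  "mart_diff P X t \<omega> = X t \<omega> - cond_expX P X t (t - 1) \<omega>"

definition JJ :: "'w measure \<Rightarrow> (nat \<Rightarrow> 'w \<Rightarrow> real ^ 'n) \<Rightarrow> nat \<Rightarrow> 'w \<Rightarrow> 'n set" where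
  "JJ P X t \<omega> =
     {j. real_cond_exp (completion P) (filt P X t)
           (indicator {\<omega>' \<in> space P. X (t + 1) \<omega>' = axis j 1}) \<omega> > 0}"

definition Linf :: "'w measure \<Rightarrow> 'w measure \<Rightarrow> ('w \<Rightarrow> 'b::real_normed_vector) set" where
  "Linf P G = {Y. Y \<in> borel_measurable G \<and> (\<exists>C. AE \<omega> in P. norm (Y \<omega>) \<le> C)}"

definition adapted ::
    "'w measure \<Rightarrow> nat \<Rightarrow> (nat \<Rightarrow> 'w \<Rightarrow> real ^ 'n) \<Rightarrow> (nat \<Rightarrow> 'w \<Rightarrow> 'b::real_normed_vector) \<Rightarrow> bool" where
  "adapted P T X Y \<longleftrightarrow> (\<forall>t\<le>T. Y t \<in> Linf P (filt P X t))"

type_synonym ('w, 'k, 'n) driver = "'w \<Rightarrow> nat \<Rightarrow> real ^ 'k \<Rightarrow> real ^ 'n ^ 'k \<Rightarrow> real ^ 'k"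

definition is_driver ::
    "'w measure \<Rightarrow> nat \<Rightarrow> (nat \<Rightarrow> 'w \<Rightarrow> real ^ 'n) \<Rightarrow> ('w, 'k::finite, 'n::finite) driver \<Rightarrow> bool" where
  "is_driver P T X F \<longleftrightarrow>
     (\<forall>t\<le>T. \<forall>y z. (\<lambda>\<omega>. F \<omega> t y z) \<in> borel_measurable (filt P X t)) \<and>
     (\<forall>t\<le>T. \<forall>Y \<in> Linf P (filt P X t). \<forall>Z \<in> Linf P (filt P X t).
        (\<lambda>\<omega>. F \<omega> t (Y \<omega>) (Z \<omega>)) \<in> Linf P (filt P X t))"

definition equiv_M ::
    "'w measure \<Rightarrow> nat \<Rightarrow> (nat \<Rightarrow> 'w \<Rightarrow> real ^ 'n)
      \<Rightarrow> (nat \<Rightarrow> 'w \<Rightarrow> real ^ 'n ^ 'k) \<Rightarrow> (nat \<Rightarrow> 'w \<Rightarrow> real ^ 'n ^ 'k) \<Rightarrow> bool" where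
  "equiv_M P T X Z1 Z2 \<longleftrightarrow>
     (\<forall>u<T. AE \<omega> in P. Z1 u \<omega> *v mart_diff P X (u + 1) \<omega> = Z2 u \<omega> *v mart_diff P X (u + 1) \<omega>)"

text \<open>A map \<open>\<Phi>\<close> on random variables (compatible with almost sure equality) induces a bijection of the
  \<open>G\<close>-measurable random variables modulo almost sure equality onto themselves. Quotients are avoided:
  the three conjuncts are well-definedness, injectivity and surjectivity on classes.\<close>

definition bij_mod_AE ::
    "'w measure \<Rightarrow> 'w measure \<Rightarrow> (('w \<Rightarrow> real ^ 'k) \<Rightarrow> 'w \<Rightarrow> real ^ 'k) \<Rightarrow> bool" where
  "bij_mod_AE P G \<Phi> \<longleftrightarrow>
     (\<forall>Y \<in> borel_measurable G. \<Phi> Y \<in> borel_measurable G) \<and>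
     (\<forall>Y \<in> borel_measurable G. \<forall>Y' \<in> borel_measurable G.
        (AE \<omega> in P. \<Phi> Y \<omega> = \<Phi> Y' \<omega>) \<longrightarrow> (AE \<omega> in P. Y \<omega> = Y' \<omega>)) \<and>
     (\<forall>V \<in> borel_measurable G. \<exists>Y \<in> borel_measurable G. AE \<omega> in P. \<Phi> Y \<omega> = V \<omega>)"

definition regular_driver ::
    "'w measure \<Rightarrow> nat \<Rightarrow> (nat \<Rightarrow> 'w \<Rightarrow> real ^ 'n) \<Rightarrow> ('w, 'k::finite, 'n::finite) driver \<Rightarrow> bool" where
  "regular_driver P T X F \<longleftrightarrow> is_driver P T X F \<and>
     (\<forall>Y Z1 Z2. adapted P T X Y \<and> adapted P T X Z1 \<and> adapted P T X Z2 \<and> equiv_M P T X Z1 Z2 \<longrightarrow>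
        (\<forall>t<T. AE \<omega> in P. F \<omega> t (Y t \<omega>) (Z1 t \<omega>) = F \<omega> t (Y t \<omega>) (Z2 t \<omega>))) \<and>
     (\<forall>Z. adapted P T X Z \<longrightarrow>
        (\<forall>t<T. bij_mod_AE P (filt P X t) (\<lambda>Y \<omega>. Y \<omega> - F \<omega> t (Y \<omega>) (Z t \<omega>))))"

definition bsde_solution ::
    "'w measure \<Rightarrow> nat \<Rightarrow> (nat \<Rightarrow> 'w \<Rightarrow> real ^ 'n) \<Rightarrow> ('w, 'k::finite, 'n::finite) driver
      \<Rightarrow> ('w \<Rightarrow> real ^ 'k) \<Rightarrow> (nat \<Rightarrow> 'w \<Rightarrow> real ^ 'k) \<Rightarrow> (nat \<Rightarrow> 'w \<Rightarrow> real ^ 'n ^ 'k) \<Rightarrow> bool" where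
  "bsde_solution P T X F Q Y Z \<longleftrightarrow> adapted P T X Y \<and> adapted P T X Z \<and>
     (\<forall>t\<le>T. AE \<omega> in P.
        Y t \<omega> - (\<Sum>u\<in>{t..<T}. F \<omega> u (Y u \<omega>) (Z u \<omega>))
          + (\<Sum>u\<in>{t..<T}. Z u \<omega> *v mart_diff P X (u + 1) \<omega>) = Q \<omega>)"

end

(* Subtracting the BSDE at times t and t + 1 gives
     Y_t - F(t, Y_t, Z_t) + Z_t M_(t+1) = Y_(t+1),
   so if Y1_(t+1) \<ge> Y2_(t+1), an F_t-measurable quantity plus e_i^* (Z1_t - Z2_t) X_(t+1) is
   nonnegative. By conditioning on F_t, it stays nonnegative when X_(t+1) is replaced by any basis
   vector of positive conditional probability, in particular by the one attaining the minimum in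
   (iii). Together with (ii) and (iii) this yields the premise of (iv), and the comparison propagates
   backwards from time T. *)

theory Submission
  imports Defs
begin

text \<open>With \<open>B\<close> the \<open>F\<close>-measurable set where \<open>g\<close> is
  negative, the hypothesis makes the product of the indicators of \<open>B\<close> and
  \<open>C\<close> vanish a.e. Pulling the indicator of \<open>B\<close> out of the conditional
  expectation shows that the conditional probability of \<open>C\<close> is zero a.e. on
  \<open>B\<close>.\<close>

lemma (in finite_measure_subalgebra) AE_nonneg_if_real_cond_exp_indicator_pos:
  fixes g :: "'a \<Rightarrow> real"
  assumes g [measurable]: "g \<in> borel_measurable F" and C [measurable]: "C \<in> sets M"
    and nonneg: "AE x in M. x \<in> C \<longrightarrow> 0 \<le> g x"
  shows "AE x in M. 0 < real_cond_exp M F (indicator C) x \<longrightarrow> 0 \<le> g x"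
proof -
  define B where "B = {x \<in> space F. g x < 0}"
  have B [measurable]: "B \<in> sets F"
    unfolding B_def by measurable
  have BM [measurable]: "B \<in> sets M"
    using B subalg by (auto simp: subalgebra_def)
  have int: "integrable M (\<lambda>x. indicator B x * (indicator C x :: real))"
    by (rule integrable_const_bound[where B = 1]) (auto simp: indicator_def)
  have "AE x in M. real_cond_exp M F (\<lambda>x. indicator B x * (indicator C x :: real)) x
      = indicator B x * real_cond_exp M F (indicator C) x"
    by (rule real_cond_exp_mult) (use int in auto)
  moreover have "AE x in M. real_cond_exp M F (\<lambda>x. indicator B x * (indicator C x :: real)) x
      = real_cond_exp M F (\<lambda>x. 0) x"
  proof (rule real_cond_exp_cong)
    show "AE x in M. indicator B x * (indicator C x :: real) = 0"
      using nonneg by eventually_elim (auto simp: B_def indicator_def)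
  qed measurable
  moreover have "AE x in M. real_cond_exp M F (\<lambda>x. 0 :: real) x = 0"
    by (rule real_cond_exp_F_meas) auto
  ultimately show ?thesis
    using AE_space
  proof eventually_elim
    case (elim x)
    then have "x \<in> space F"
      using subalg by (auto simp: subalgebra_def)
    with elim show ?case
      by (cases "g x < 0") (auto simp: B_def indicator_def)
  qed
qed

text \<open>The indicators of a finite cover sum to at least 1 a.e., hence so do their conditional
  expectations, and these cannot all be nonpositive. Disjointness does not enter.\<close>

lemma (in finite_measure_subalgebra) AE_ex_real_cond_exp_indicator_pos:
  fixes C :: "'i::finite \<Rightarrow> 'a set"
  assumes C [measurable]: "\<And>j. C j \<in> sets M" and cover: "AE x in M. \<exists>j. x \<in> C j"
  shows "AE x in M. \<exists>j. 0 < real_cond_exp M F (indicator (C j)) x"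
proof -
  have int: "integrable M (indicator (C j) :: 'a \<Rightarrow> real)" for j
    by (rule integrable_const_bound[where B = 1]) (auto simp: indicator_def)
  have "AE x in M. real_cond_exp M F (\<lambda>x. \<Sum>j\<in>UNIV. indicator (C j) x :: real) x
      = (\<Sum>j\<in>UNIV. real_cond_exp M F (indicator (C j)) x)"
    by (rule real_cond_exp_sum) (use int in auto)
  moreover have "AE x in M. 1 \<le> real_cond_exp M F (\<lambda>x. \<Sum>j\<in>UNIV. indicator (C j) x :: real) x"
  proof (rule real_cond_exp_ge_c)
    show "AE x in M. 1 \<le> (\<Sum>j\<in>UNIV. indicator (C j) x :: real)"
      using cover
    proof eventually_elim
      case (elim x)
      then obtain j where "x \<in> C j" by blast
      then have "1 = (indicator (C j) x :: real)" by simp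
      also have "\<dots> \<le> (\<Sum>j\<in>UNIV. indicator (C j) x)"
        by (rule member_le_sum) auto
      finally show ?case .
    qed
  qed (use int in auto)
  ultimately show ?thesis
  proof eventually_elim
    case (elim x)
    show ?case
    proof (rule ccontr)
      assume "\<not> ?case"
      then have "(\<Sum>j\<in>UNIV. real_cond_exp M F (indicator (C j)) x) \<le> 0"
        by (intro sum_nonpos) (auto simp: not_less)
      with elim show False by simp
    qed
  qed
qed

lemma borel_measurable_vec_nth_comp:
  fixes f :: "'a \<Rightarrow> ('b::real_normed_vector) ^ ('n::finite)"
  assumes "f \<in> borel_measurable M"
  shows "(\<lambda>x. f x $ i) \<in> borel_measurable M"
  by (rule measurable_compose[OF assms]) (intro borel_measurable_continuous_onI continuous_intros)

lemma finite_measure_subalgebra_filt: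
  assumes "prob_space P" and "basis_process P T X" and "t \<le> T"
  shows "finite_measure_subalgebra (completion P) (filt P X t)"
proof -
  interpret prob_space "completion P"
    using assms(1) by (rule prob_space.prob_space_completion)
  show ?thesis
    by unfold_locales (rule subalgebra_filt[OF assms(2,3)])
qed

lemma sets_basis_process_eq_axis:
  assumes "basis_process P T X" and "t \<le> T"
  shows "{\<omega> \<in> space P. X t \<omega> = axis j 1} \<in> sets P"
proof -
  have [measurable]: "X t \<in> borel_measurable P"
    using assms by (auto simp: basis_process_def)
  show ?thesis by measurable
qed

text \<open>Ensures that \<open>Min\<close> in hypothesis (iii) is a genuine minimum, since
  \<open>Min\<close> of the empty set is unspecified. The events that \<open>X (t + 1)\<close>
  equals a given basis vector cover the space.\<close>

lemma AE_JJ_nonempty: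
  assumes "prob_space P" and "basis_process P T X" and "t < T"
  shows "AE \<omega> in P. JJ P X t \<omega> \<noteq> {}"
proof -
  interpret finite_measure_subalgebra "completion P" "filt P X t"
    using assms by (intro finite_measure_subalgebra_filt) auto
  have "AE \<omega> in completion P. \<exists>j. 0 < real_cond_exp (completion P) (filt P X t)
      (indicator {\<omega>' \<in> space P. X (t + 1) \<omega>' = axis j 1}) \<omega>"
  proof (rule AE_ex_real_cond_exp_indicator_pos)
    show "{\<omega>' \<in> space P. X (t + 1) \<omega>' = axis j 1} \<in> sets (completion P)" for j
      using assms by (intro sets_completionI_sets sets_basis_process_eq_axis) auto
    show "AE \<omega> in completion P. \<exists>j. \<omega> \<in> {\<omega>' \<in> space P. X (t + 1) \<omega>' = axis j 1}"
      using assms by (intro AE_I2) (auto simp: basis_process_def)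
  qed
  then show ?thesis
    by (auto simp: JJ_def AE_completion_iff)
qed

text \<open>This is the conditioning step. For fixed \<open>i\<close> and \<open>j\<close>, the
  expression with \<open>axis j 1\<close> in place of \<open>X (t + 1)\<close> is known at time
  \<open>t\<close> and is nonnegative a.s. on the event that \<open>X (t + 1)\<close> equals
  \<open>axis j 1\<close>. It is therefore nonnegative wherever that event has positive conditional
  probability.\<close>

lemma AE_JJ_nonneg:
  fixes X :: "nat \<Rightarrow> 'w \<Rightarrow> real ^ 'n" and A :: "'w \<Rightarrow> real ^ 'k" and Z :: "'w \<Rightarrow> real ^ 'n ^ 'k"
  assumes "prob_space P" and X: "basis_process P T X" and t: "t < T"
    and A: "A \<in> borel_measurable (filt P X t)" and Z: "Z \<in> borel_measurable (filt P X t)"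
    and nonneg: "AE \<omega> in P. 0 \<le> A \<omega> + Z \<omega> *v mart_diff P X (t + 1) \<omega>"
  shows "AE \<omega> in P. \<forall>i. \<forall>j\<in>JJ P X t \<omega>.
    0 \<le> A \<omega> $ i + (Z \<omega> *v (axis j 1 - cond_expX P X (t + 1) t \<omega>)) $ i"
proof -
  interpret finite_measure_subalgebra "completion P" "filt P X t"
    using assms by (intro finite_measure_subalgebra_filt) auto
  have "AE \<omega> in completion P.
      0 < real_cond_exp (completion P) (filt P X t)
        (indicator {\<omega>' \<in> space P. X (t + 1) \<omega>' = axis j 1}) \<omega>
      \<longrightarrow> 0 \<le> A \<omega> $ i + (Z \<omega> *v (axis j 1 - cond_expX P X (t + 1) t \<omega>)) $ i" for i j
  proof (rule AE_nonneg_if_real_cond_exp_indicator_pos)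
    have [measurable]: "(\<lambda>\<omega>. A \<omega> $ i) \<in> borel_measurable (filt P X t)"
      "(\<lambda>\<omega>. Z \<omega> $ i $ l) \<in> borel_measurable (filt P X t)" for l
      using A Z by (auto intro!: borel_measurable_vec_nth_comp)
    show "(\<lambda>\<omega>. A \<omega> $ i + (Z \<omega> *v (axis j 1 - cond_expX P X (t + 1) t \<omega>)) $ i)
        \<in> borel_measurable (filt P X t)"
      \<comment> \<open>In coordinates this is a finite sum of products of real functions measurable
        for \<open>filt P X t\<close>; each \<open>real_cond_exp\<close> is measurable for its
        subalgebra.\<close>
      unfolding matrix_vector_mult_def cond_expX_def by simp
    show "{\<omega>' \<in> space P. X (t + 1) \<omega>' = axis j 1} \<in> sets (completion P)"
      using X t by (intro sets_completionI_sets sets_basis_process_eq_axis) auto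
    have "AE \<omega> in P. \<omega> \<in> {\<omega>' \<in> space P. X (t + 1) \<omega>' = axis j 1}
        \<longrightarrow> 0 \<le> A \<omega> $ i + (Z \<omega> *v (axis j 1 - cond_expX P X (t + 1) t \<omega>)) $ i"
      \<comment> \<open>On this event \<open>mart_diff P X (t + 1)\<close> is the vector in the
        goal, because its index shift turns \<open>t + 1\<close> into \<open>t\<close>.\<close>
      using nonneg by eventually_elim (auto simp: mart_diff_def less_eq_vec_def)
    then show "AE \<omega> in completion P. \<omega> \<in> {\<omega>' \<in> space P. X (t + 1) \<omega>' = axis j 1}
        \<longrightarrow> 0 \<le> A \<omega> $ i + (Z \<omega> *v (axis j 1 - cond_expX P X (t + 1) t \<omega>)) $ i"
      by (simp add: AE_completion_iff)
  qed
  then have "\<And>i j. AE \<omega> in P. j \<in> JJ P X t \<omega>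
      \<longrightarrow> 0 \<le> A \<omega> $ i + (Z \<omega> *v (axis j 1 - cond_expX P X (t + 1) t \<omega>)) $ i"
    by (simp add: AE_completion_iff JJ_def)
  \<comment> \<open>\<open>JJ P X t \<omega>\<close> is random, so the null sets are merged over all
    of the finitely many pairs \<open>i\<close>, \<open>j\<close>, with membership kept as a
    premise.\<close>
  then have "AE \<omega> in P. \<forall>i j. j \<in> JJ P X t \<omega>
      \<longrightarrow> 0 \<le> A \<omega> $ i + (Z \<omega> *v (axis j 1 - cond_expX P X (t + 1) t \<omega>)) $ i"
    by (intro eventually_all_finite)
  then show ?thesis
    by eventually_elim blast
qed

lemma bsde_solution_terminal:
  assumes "bsde_solution P T X F Q Y Z"
  shows "AE \<omega> in P. Y T \<omega> = Q \<omega>"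
  using assms unfolding bsde_solution_def by force

lemma bsde_solution_step:
  assumes "bsde_solution P T X F Q Y Z" and "t < T"
  shows "AE \<omega> in P. Y t \<omega> - F \<omega> t (Y t \<omega>) (Z t \<omega>) + Z t \<omega> *v mart_diff P X (t + 1) \<omega> = Y (Suc t) \<omega>"
proof -
  have eq: "AE \<omega> in P. Y s \<omega> - (\<Sum>u\<in>{s..<T}. F \<omega> u (Y u \<omega>) (Z u \<omega>))
      + (\<Sum>u\<in>{s..<T}. Z u \<omega> *v mart_diff P X (u + 1) \<omega>) = Q \<omega>" if "s \<le> T" for s
    using assms(1) that unfolding bsde_solution_def by blast
  have "t \<le> T" "Suc t \<le> T"
    using assms(2) by auto
  from eq[OF this(1)] eq[OF this(2)] show ?thesis
  proof eventually_elim
    case (elim \<omega>)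
    \<comment> \<open>\<open>Q\<close> is eliminated between the equations at \<open>t\<close> and
      \<open>Suc t\<close>; splitting off the summand \<open>u = t\<close> lets the remaining sums
      cancel.\<close>
    from trans[OF elim(1) elim(2)[symmetric]] show ?case
      unfolding sum.atLeast_Suc_lessThan[OF assms(2)] by (simp add: algebra_simps)
  qed
qed

text \<open>Supplies the measurability needed for conditioning at time \<open>t\<close>.
  Measurability of the driver at fixed \<open>y\<close> and \<open>z\<close> would not give that of
  the composite; it comes from the \<open>Linf\<close> clause of \<open>is_driver\<close>,
  applicable because solutions are adapted.\<close>

lemma bsde_solution_increment_measurable:
  fixes F :: "('w, 'k::finite, 'n::finite) driver"
  assumes "regular_driver P T X F" and "bsde_solution P T X F Q Y Z" and "t < T"
  shows "(\<lambda>\<omega>. Y t \<omega> - F \<omega> t (Y t \<omega>) (Z t \<omega>)) \<in> borel_measurable (filt P X t)"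
    and "Z t \<in> borel_measurable (filt P X t)"
proof -
  have YZ: "Y t \<in> Linf P (filt P X t)" "Z t \<in> Linf P (filt P X t)"
    using assms(2,3) by (auto simp: bsde_solution_def adapted_def)
  then have "(\<lambda>\<omega>. F \<omega> t (Y t \<omega>) (Z t \<omega>)) \<in> Linf P (filt P X t)"
    using assms(1,3) by (auto simp: regular_driver_def is_driver_def)
  with YZ show "(\<lambda>\<omega>. Y t \<omega> - F \<omega> t (Y t \<omega>) (Z t \<omega>)) \<in> borel_measurable (filt P X t)"
    and "Z t \<in> borel_measurable (filt P X t)"
    by (auto simp: Linf_def)
qed

theorem theorem4p1:
  fixes P :: "'w measure" and T :: nat
    and X :: "nat \<Rightarrow> 'w \<Rightarrow> real ^ 'n"
    and F1 F2 :: "('w, 'k::finite, 'n::finite) driver"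
    and Q1 Q2 :: "'w \<Rightarrow> real ^ 'k"
    and Y1 Y2 :: "nat \<Rightarrow> 'w \<Rightarrow> real ^ 'k"
    and Z1 Z2 :: "nat \<Rightarrow> 'w \<Rightarrow> real ^ 'n ^ 'k"
  assumes "prob_space P" and "T \<ge> 1" and "basis_process P T X"
    and "regular_driver P T X F1" and "regular_driver P T X F2"
    and "Q1 \<in> Linf P (filt P X T)" and "Q2 \<in> Linf P (filt P X T)"
    and "bsde_solution P T X F1 Q1 Y1 Z1" and "bsde_solution P T X F2 Q2 Y2 Z2"
    and i: "AE \<omega> in P. Q1 \<omega> \<ge> Q2 \<omega>"
    and ii: "AE \<omega> in P. \<forall>t<T. F1 \<omega> t (Y2 t \<omega>) (Z2 t \<omega>) \<ge> F2 \<omega> t (Y2 t \<omega>) (Z2 t \<omega>)"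
    and iii: "AE \<omega> in P. \<forall>t<T. \<forall>i.
        F1 \<omega> t (Y2 t \<omega>) (Z1 t \<omega>) $ i - F1 \<omega> t (Y2 t \<omega>) (Z2 t \<omega>) $ i
          \<ge> Min ((\<lambda>j. ((Z1 t \<omega> - Z2 t \<omega>) *v (axis j 1 - cond_expX P X (t + 1) t \<omega>)) $ i)
                   ` JJ P X t \<omega>)"
    and iv: "AE \<omega> in P. \<forall>t<T.
        Y1 t \<omega> - F1 \<omega> t (Y1 t \<omega>) (Z1 t \<omega>) \<ge> Y2 t \<omega> - F1 \<omega> t (Y2 t \<omega>) (Z1 t \<omega>)
          \<longrightarrow> Y1 t \<omega> \<ge> Y2 t \<omega>"
  shows "AE \<omega> in P. \<forall>t\<le>T. Y1 t \<omega> \<ge> Y2 t \<omega>"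
proof -
  have comparison: "AE \<omega> in P. Y1 t \<omega> \<ge> Y2 t \<omega>" if "t \<le> T" for t
    using that
  \<comment> \<open>Backward induction: the base case is time \<open>T\<close>, and the step passes
    from \<open>Suc t\<close> to \<open>t\<close> for \<open>t < T\<close>.\<close>
  proof (induction rule: inc_induct)
    case base
    show ?case
      using i bsde_solution_terminal[OF assms(8)] bsde_solution_terminal[OF assms(9)]
      by eventually_elim simp
  next
    case (step t)
    \<comment> \<open>The part of \<open>Y1 (Suc t) - Y2 (Suc t)\<close> known at time
      \<open>t\<close>, each solution taken with its own driver.\<close>
    define A where "A = (\<lambda>\<omega>. (Y1 t \<omega> - F1 \<omega> t (Y1 t \<omega>) (Z1 t \<omega>)) - (Y2 t \<omega> - F2 \<omega> t (Y2 t \<omega>) (Z2 t \<omega>)))"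
    note meas = bsde_solution_increment_measurable[OF assms(4,8) \<open>t < T\<close>]
      bsde_solution_increment_measurable[OF assms(5,9) \<open>t < T\<close>]
    have "AE \<omega> in P. 0 \<le> A \<omega> + (Z1 t \<omega> - Z2 t \<omega>) *v mart_diff P X (t + 1) \<omega>"
      using step.IH bsde_solution_step[OF assms(8) \<open>t < T\<close>] bsde_solution_step[OF assms(9) \<open>t < T\<close>]
    proof eventually_elim
      case (elim \<omega>)
      have "A \<omega> + (Z1 t \<omega> - Z2 t \<omega>) *v mart_diff P X (t + 1) \<omega> = Y1 (Suc t) \<omega> - Y2 (Suc t) \<omega>"
        unfolding elim(2,3)[symmetric] A_def by (simp add: matrix_vector_mult_diff_rdistrib)
      with elim(1) show ?case by (simp add: less_eq_vec_def)
    qed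
    then have "AE \<omega> in P. \<forall>i. \<forall>j\<in>JJ P X t \<omega>.
        0 \<le> A \<omega> $ i + ((Z1 t \<omega> - Z2 t \<omega>) *v (axis j 1 - cond_expX P X (t + 1) t \<omega>)) $ i"
      using meas by (intro AE_JJ_nonneg[OF assms(1,3) \<open>t < T\<close>]) (auto simp: A_def)
    then show ?case
      using AE_JJ_nonempty[OF assms(1,3) \<open>t < T\<close>] ii iii iv
    proof eventually_elim
      case (elim \<omega>)
      \<comment> \<open>The premise of (iv). In each coordinate \<open>A\<close> is at least minus
        the minimum in (iii). Replacing the \<open>F2\<close> term in \<open>A\<close> by
        \<open>F1\<close> at \<open>Y2\<close>, \<open>Z2\<close> costs nothing by (ii), and (iii)
        then absorbs the minimum in passing from \<open>Z2\<close> to \<open>Z1\<close>.\<close>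
      have "Y2 t \<omega> - F1 \<omega> t (Y2 t \<omega>) (Z1 t \<omega>) \<le> Y1 t \<omega> - F1 \<omega> t (Y1 t \<omega>) (Z1 t \<omega>)"
        unfolding less_eq_vec_def
      proof
        fix i
        let ?m = "\<lambda>j. ((Z1 t \<omega> - Z2 t \<omega>) *v (axis j 1 - cond_expX P X (t + 1) t \<omega>)) $ i"
        \<comment> \<open>The minimum is attained at some index in \<open>JJ P X t \<omega>\<close>,
          which may depend on \<open>i\<close> and \<open>\<omega>\<close>; the nonnegativity for
          all such indices applies there.\<close>
        have "Min (?m ` JJ P X t \<omega>) \<in> ?m ` JJ P X t \<omega>"
          using elim(2) by (intro Min_in) auto
        then have "0 \<le> A \<omega> $ i + Min (?m ` JJ P X t \<omega>)"
          using elim(1) by auto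
        moreover have "Min (?m ` JJ P X t \<omega>)
            \<le> F1 \<omega> t (Y2 t \<omega>) (Z1 t \<omega>) $ i - F1 \<omega> t (Y2 t \<omega>) (Z2 t \<omega>) $ i"
          using elim(4) \<open>t < T\<close> by blast
        moreover have "F2 \<omega> t (Y2 t \<omega>) (Z2 t \<omega>) $ i \<le> F1 \<omega> t (Y2 t \<omega>) (Z2 t \<omega>) $ i"
          using elim(3) \<open>t < T\<close> by (auto simp: less_eq_vec_def)
        ultimately show "(Y2 t \<omega> - F1 \<omega> t (Y2 t \<omega>) (Z1 t \<omega>)) $ i
            \<le> (Y1 t \<omega> - F1 \<omega> t (Y1 t \<omega>) (Z1 t \<omega>)) $ i"
          by (simp add: A_def)
      qed
      with elim(5) \<open>t < T\<close> show ?case by blast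
    qed
  qed
  \<comment> \<open>Only finitely many times occur, so one null set serves them all.\<close>
  have "AE \<omega> in P. \<forall>t\<in>{..T}. Y1 t \<omega> \<ge> Y2 t \<omega>"
    using comparison by (intro eventually_ball_finite) auto
  then show ?thesis
    unfolding Ball_def atMost_iff .
qed

end
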